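(* Let $\tau,\tau'$ be tasks scheduled by a static scheduler with priorities $\pi_\tau,\pi_{\tau'}$, a higher number meaning higher priority and jobs of equal priority being served in order of their request times. Fix a job of $\tau$ with request time $t^r_\tau$. Then for every $t\in\mathbb R$ and interval $\Delta_{a,b}=[t_a,t_b)$, the interference request bound, i.e. the total execution time of the jobs of $\tau'$ requested in $[t_a,t_b)$ and no later than $t$ that interfere with the considered job of $\tau$, is $$\rho^{\pi_{\tau'}\ge\pi_\tau}_{\tau,\tau'}(t,\Delta_{a,b})=\int_{-\infty}^{t}\sum_{e\in E_{\tau'}}\sum_{n=0}^{k-1}\delta(t'-a_e-np_e)\,C^n_{\tau',e}\,\big[H^l(\pi_{\tau'}-\pi_\tau)+\delta_{\pi_{\tau'},\pi_\tau}H^u(t^r_\tau-t^r_{\tau',e,n})\big]H^u(t'-t_a)H^l(t_b-t')\,dt',$$ where $t^r_{\tau',e,n}=a_e+np_e$. Under deadline monotonic scheduling (the task with the smaller relative deadline $d$ has higher priority, ties again resolved by request times), it is $$\rho^{d_{\tau'}\le d_\tau}_{\tau,\tau'}(t,\Delta_{a,b})=\int_{-\infty}^{t}\sum_{e\in E_{\tau'}}\sum_{n=0}^{k-1}\delta(t'-a_e-np_e)\,C^n_{\tau',e}\,\big[H^l(d_\tau-d_{\tau'})+\delta_{d_\tau,d_{\tau'}}H^u(t^r_\tau-t^r_{\tau',e,n})\big]H^u(t'-t_a)H^l(t_b-t')\,dt'.$$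
   Context: A task $\tau'$ has a finite event list $E_{\tau'}$ of event tuples $e$ with period $p_e\ge0$ and minimal distance $a_e\ge0$, and a bound $k\in\mathbb N\cup\{\infty\}$ (all $p_e>0$ if $k=\infty$). Its jobs are the pairs $(e,n)$ with $e\in E_{\tau'}$, $0\le n\le k-1$ (all $n\ge 0$ if $k=\infty$); job $(e,n)$ is requested at time $a_e+np_e$ and has execution time $C^n_{\tau',e}\ge0$. A job of $\tau'$ interferes with the considered job of $\tau$ iff $\tau'$ has strictly higher priority than $\tau$, or the priorities are equal and the job of $\tau'$ is requested no later than the considered job. $\delta(t'-s)\,dt'$ is the unit point mass at $s$; $\int_{-\infty}^t$ is over $(-\infty,t]$, including a point mass at $t$; $\delta_{x,y}$ with two indices is the Kronecker delta. $H^u(x)=1$ for $x\ge0$, $0$ for $x<0$; $H^l(x)=1$ for $x>0$, $0$ for $x\le0$. *)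

theory Defs
  imports "HOL-Probability.Probability"
begin

text \<open>
  Events are addressed by their position in the event list, so that equal event tuples at
  different positions are different events, each with its own execution times.
\<close>

record event =
  period :: real
  min_dist :: real

record task =
  events :: "event list"
  job_bound :: enat
  exec_time :: "nat \<Rightarrow> nat \<Rightarrow> real"
  priority :: real
  deadline :: real

definition jobs :: "task \<Rightarrow> (nat \<times> nat) set" where
  "jobs \<tau> = {(e, n). e < length (events \<tau>) \<and> enat n < job_bound \<tau>}"

definition request_time :: "task \<Rightarrow> nat \<Rightarrow> nat \<Rightarrow> real" where
  "request_time \<tau> e n = min_dist (events \<tau> ! e) + real n * period (events \<tau> ! e)"

definition valid_task :: "task \<Rightarrow> bool" where
  "valid_task \<tau> \<longleftrightarrow>
     (\<forall>ev \<in> set (events \<tau>). period ev \<ge> 0 \<and> min_dist ev \<ge> 0) \<and>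
     (job_bound \<tau> = \<infinity> \<longrightarrow> (\<forall>ev \<in> set (events \<tau>). period ev > 0)) \<and>
     (\<forall>(e, n) \<in> jobs \<tau>. exec_time \<tau> e n \<ge> 0)"

text \<open>
  The following two predicates say that job \<open>(e', n')\<close> of \<open>\<tau>'\<close> interferes with job \<open>(e, n)\<close> of \<open>\<tau>\<close>.
\<close>

definition interferes_static :: "task \<Rightarrow> nat \<times> nat \<Rightarrow> task \<Rightarrow> nat \<times> nat \<Rightarrow> bool" where
  "interferes_static \<tau> = (\<lambda>(e, n) \<tau>' (e', n').
     priority \<tau>' > priority \<tau> \<or>
     priority \<tau>' = priority \<tau> \<and> request_time \<tau>' e' n' \<le> request_time \<tau> e n)"

definition interferes_dm :: "task \<Rightarrow> nat \<times> nat \<Rightarrow> task \<Rightarrow> nat \<times> nat \<Rightarrow> bool" where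
  "interferes_dm \<tau> = (\<lambda>(e, n) \<tau>' (e', n').
     deadline \<tau>' < deadline \<tau> \<or>
     deadline \<tau>' = deadline \<tau> \<and> request_time \<tau>' e' n' \<le> request_time \<tau> e n)"

definition interfering_jobs ::
  "(task \<Rightarrow> nat \<times> nat \<Rightarrow> task \<Rightarrow> nat \<times> nat \<Rightarrow> bool) \<Rightarrow> task \<Rightarrow> nat \<times> nat \<Rightarrow> task \<Rightarrow>
     real \<Rightarrow> real \<Rightarrow> real \<Rightarrow> (nat \<times> nat) set" where
  "interfering_jobs interf \<tau> j \<tau>' t ta tb =
     {(e, n) \<in> jobs \<tau>'. interf \<tau> j \<tau>' (e, n) \<and>
        request_time \<tau>' e n \<in> {ta..<tb} \<and> request_time \<tau>' e n \<le> t}"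

definition interference_request_bound ::
  "(task \<Rightarrow> nat \<times> nat \<Rightarrow> task \<Rightarrow> nat \<times> nat \<Rightarrow> bool) \<Rightarrow> task \<Rightarrow> nat \<times> nat \<Rightarrow> task \<Rightarrow>
     real \<Rightarrow> real \<Rightarrow> real \<Rightarrow> real" where
  "interference_request_bound interf \<tau> j \<tau>' t ta tb =
     (\<Sum>(e, n) \<in> interfering_jobs interf \<tau> j \<tau>' t ta tb. exec_time \<tau>' e n)"

text \<open>For valid tasks the sum above ranges over a finite set, so it is a genuine total.\<close>

lemma finite_interfering_jobs:
  assumes "valid_task \<tau>'"
  shows "finite (interfering_jobs interf \<tau> j \<tau>' t ta tb)"
proof -
  define N where "N e = {n. enat n < job_bound \<tau>' \<and> request_time \<tau>' e n < tb}" for e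
  have "finite (N e)" if e: "e < length (events \<tau>')" for e
  proof (cases "job_bound \<tau>'")
    case (enat k)
    then have "N e \<subseteq> {..<k}" by (auto simp: N_def)
    then show ?thesis by (rule finite_subset) simp
  next
    case infinity
    let ?p = "period (events \<tau>' ! e)" and ?a = "min_dist (events \<tau>' ! e)"
    have p: "?p > 0" using assms infinity e by (auto simp: valid_task_def)
    have "N e \<subseteq> {..nat \<lceil>(tb - ?a) / ?p\<rceil>}"
    proof
      fix n assume "n \<in> N e"
      then have "real n * ?p < tb - ?a" by (simp add: N_def request_time_def)
      then have "real n < (tb - ?a) / ?p" using p by (simp add: field_simps)
      then show "n \<in> {..nat \<lceil>(tb - ?a) / ?p\<rceil>}" by simp linarith
    qed
    then show ?thesis by (rule finite_subset) simp
  qed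
  then have "finite (SIGMA e:{..<length (events \<tau>')}. N e)" by auto
  moreover have "interfering_jobs interf \<tau> j \<tau>' t ta tb \<subseteq> (SIGMA e:{..<length (events \<tau>')}. N e)"
    by (auto simp: interfering_jobs_def jobs_def N_def)
  ultimately show ?thesis by (rule finite_subset[rotated])
qed

definition Hu :: "real \<Rightarrow> real" where
  "Hu x = (if x \<ge> 0 then 1 else 0)"

definition Hl :: "real \<Rightarrow> real" where
  "Hl x = (if x > 0 then 1 else 0)"

definition kronecker :: "real \<Rightarrow> real \<Rightarrow> real" where
  "kronecker x y = (if x = y then 1 else 0)"

text \<open>
  \<open>sum_measure I M\<close> is the sum of the Borel measures \<open>M i\<close>, \<open>i \<in> I\<close>; the integral over
  \<open>count_space I\<close> is the possibly infinite sum over \<open>I\<close> in \<^typ>\<open>ennreal\<close>. Together with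
  \<open>density (return borel s) g\<close> for \<open>g(t') \<delta>(t' - s) dt'\<close> it expresses sums of weighted point masses.
\<close>

definition sum_measure :: "'i set \<Rightarrow> ('i \<Rightarrow> real measure) \<Rightarrow> real measure" where
  "sum_measure I M = measure_of UNIV (sets borel) (\<lambda>A. \<integral>\<^sup>+ i. emeasure (M i) A \<partial>count_space I)"

lemma sets_sum_measure [simp, measurable_cong]: "sets (sum_measure I M) = sets borel"
  using sets.sigma_sets_eq[of "borel :: real measure"]
  by (simp add: sum_measure_def)

lemma space_sum_measure [simp]: "space (sum_measure I M) = UNIV"
  by (simp add: sum_measure_def space_measure_of_conv)

lemma emeasure_sum_measure:
  assumes M: "\<And>i. i \<in> I \<Longrightarrow> sets (M i) = sets borel" and A: "A \<in> sets borel"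
  shows "emeasure (sum_measure I M) A = (\<integral>\<^sup>+ i. emeasure (M i) A \<partial>count_space I)"
proof (rule emeasure_measure_of[OF sum_measure_def])
  show "sets borel \<subseteq> Pow (UNIV :: real set)" by simp
  show "A \<in> sets (sum_measure I M)" using A by simp
  show "positive (sets (sum_measure I M)) (\<lambda>A. \<integral>\<^sup>+ i. emeasure (M i) A \<partial>count_space I)"
    by (simp add: positive_def)
  show "countably_additive (sets (sum_measure I M)) (\<lambda>A. \<integral>\<^sup>+ i. emeasure (M i) A \<partial>count_space I)"
  proof (rule countably_additiveI)
    fix B :: "nat \<Rightarrow> real set"
    assume B: "range B \<subseteq> sets (sum_measure I M)" "disjoint_family B"
    have "(\<Sum>k. \<integral>\<^sup>+ i. emeasure (M i) (B k) \<partial>count_space I) =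
          (\<integral>\<^sup>+ i. (\<Sum>k. emeasure (M i) (B k)) \<partial>count_space I)"
      by (simp add: nn_integral_suminf)
    also have "\<dots> = (\<integral>\<^sup>+ i. emeasure (M i) (\<Union>k. B k) \<partial>count_space I)"
      using B M by (intro nn_integral_cong suminf_emeasure) auto
    finally show "(\<Sum>k. \<integral>\<^sup>+ i. emeasure (M i) (B k) \<partial>count_space I) = (\<integral>\<^sup>+ i. emeasure (M i) (\<Union>k. B k) \<partial>count_space I)"
      .
  qed
qed

end

theory Submission
  imports Defs
begin

text \<open>
  The measure of \<open>{..t}\<close> under the sum of weighted point masses is an iterated sum over the jobs of
  \<open>\<tau>'\<close>. The summand of a job is its execution time if the job is one of the interfering jobs, and
  \<open>0\<close> otherwise, because the bracket of Heaviside functions is the indicator of interference.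
\<close>

lemma borel_measurable_Hu [measurable]: "Hu \<in> borel_measurable borel"
  unfolding Hu_def by measurable

lemma borel_measurable_Hl [measurable]: "Hl \<in> borel_measurable borel"
  unfolding Hl_def by measurable

lemma emeasure_density_return:
  assumes "g \<in> borel_measurable borel" and "A \<in> sets borel"
  shows "emeasure (density (return borel s) g) A = g s * indicator A s"
  using assms by (simp add: emeasure_density nn_integral_return)

text \<open>The two scheduling policies differ only in the bracket. Keeping it as an abstract 0/1
  weight \<open>w\<close> independent of \<open>t'\<close> lets one argument serve both.\<close>

lemma interference_request_bound_eq_integral:
  assumes "valid_task \<tau>'"
    and w: "\<And>e n. w e n = of_bool (interf \<tau> j \<tau>' (e, n))"
  shows
    "ennreal (interference_request_bound interf \<tau> j \<tau>' t ta tb) =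
       (\<integral>\<^sup>+ t'\<in>{..t}. 1
         \<partial>sum_measure {..<length (events \<tau>')} (\<lambda>e. sum_measure {n. enat n < job_bound \<tau>'} (\<lambda>n.
            density (return borel (request_time \<tau>' e n))
              (\<lambda>t'. ennreal (exec_time \<tau>' e n * w e n * Hu (t' - ta) * Hl (tb - t'))))))"
    (is "_ = (\<integral>\<^sup>+ t'\<in>{..t}. 1 \<partial>sum_measure ?E (\<lambda>e. sum_measure ?N (?D e)))")
proof -
  let ?J = "interfering_jobs interf \<tau> j \<tau>' t ta tb"
  let ?F = "\<lambda>(e, n). ennreal (exec_time \<tau>' e n) * indicator ?J (e, n)"
  \<comment> \<open>The point mass evaluates the density at the request time. There
    \<open>Hu\<close> and \<open>Hl\<close> cut out the half-open interval, with \<open>Hl\<close>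
    excluding \<open>tb\<close>, and the set \<open>{..t}\<close> keeps a request exactly at
    \<open>t\<close>.\<close>
  have D: "emeasure (?D e n) {..t} = ?F (e, n)" if "e \<in> ?E" "n \<in> ?N" for e n
    using that
    by (auto simp: emeasure_density_return interfering_jobs_def jobs_def w Hu_def Hl_def
        split: split_indicator)
  have "(\<integral>\<^sup>+ t'\<in>{..t}. 1 \<partial>sum_measure ?E (\<lambda>e. sum_measure ?N (?D e))) =
        (\<integral>\<^sup>+ e. \<integral>\<^sup>+ n. emeasure (?D e n) {..t} \<partial>count_space ?N \<partial>count_space ?E)"
    by (simp add: emeasure_sum_measure)
  also have "\<dots> = (\<integral>\<^sup>+ e. \<integral>\<^sup>+ n. ?F (e, n) \<partial>count_space ?N \<partial>count_space ?E)"
    by (intro nn_integral_cong) (simp add: D)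
  \<comment> \<open>\<open>?F\<close> vanishes outside \<open>?J\<close>, whose members have indices
    in \<open>?E\<close> and \<open>?N\<close>. Enlarging both index sets to \<open>UNIV\<close>
    allows the iterated sum to be merged into one sum over pairs.\<close>
  also have "\<dots> = (\<integral>\<^sup>+ e. \<integral>\<^sup>+ n. ?F (e, n) \<partial>count_space UNIV \<partial>count_space UNIV)"
    by (auto simp: nn_integral_count_space_indicator interfering_jobs_def jobs_def
        intro!: nn_integral_cong split: split_indicator)
  also have "\<dots> = (\<integral>\<^sup>+ p. ?F p \<partial>count_space UNIV)"
    by (rule nn_integral_fst_count_space)
  also have "\<dots> = (\<Sum>p\<in>?J. ?F p)"
    using assms(1) by (intro nn_integral_count_space') (auto intro: finite_interfering_jobs)
  also have "\<dots> = (\<Sum>(e, n)\<in>?J. ennreal (exec_time \<tau>' e n))"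
    by (auto intro!: sum.cong)
  \<comment> \<open>\<open>ennreal\<close> sends negative reals to 0, so it commutes with the sum
    because validity makes the execution times nonnegative.\<close>
  also have "\<dots> = ennreal (\<Sum>(e, n)\<in>?J. exec_time \<tau>' e n)"
    using assms(1)
    by (subst sum_ennreal[symmetric])
      (auto intro!: sum.cong simp: valid_task_def interfering_jobs_def)
  finally show ?thesis
    by (simp add: interference_request_bound_def)
qed

theorem corollary1:
  fixes \<tau> \<tau>' :: task and e\<^sub>0 n\<^sub>0 :: nat and t ta tb :: real
  assumes "valid_task \<tau>" and "valid_task \<tau>'" and "(e\<^sub>0, n\<^sub>0) \<in> jobs \<tau>"
  shows
    "ennreal (interference_request_bound interferes_static \<tau> (e\<^sub>0, n\<^sub>0) \<tau>' t ta tb) =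
       (\<integral>\<^sup>+ t'\<in>{..t}. 1
         \<partial>sum_measure {..<length (events \<tau>')} (\<lambda>e. sum_measure {n. enat n < job_bound \<tau>'} (\<lambda>n.
            density (return borel (request_time \<tau>' e n))
              (\<lambda>t'. ennreal (exec_time \<tau>' e n *
                 (Hl (priority \<tau>' - priority \<tau>) + kronecker (priority \<tau>') (priority \<tau>) *
                    Hu (request_time \<tau> e\<^sub>0 n\<^sub>0 - request_time \<tau>' e n)) *
                 Hu (t' - ta) * Hl (tb - t'))))))
     \<and>
     ennreal (interference_request_bound interferes_dm \<tau> (e\<^sub>0, n\<^sub>0) \<tau>' t ta tb) =
       (\<integral>\<^sup>+ t'\<in>{..t}. 1
         \<partial>sum_measure {..<length (events \<tau>')} (\<lambda>e. sum_measure {n. enat n < job_bound \<tau>'} (\<lambda>n.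
            density (return borel (request_time \<tau>' e n))
              (\<lambda>t'. ennreal (exec_time \<tau>' e n *
                 (Hl (deadline \<tau> - deadline \<tau>') + kronecker (deadline \<tau>) (deadline \<tau>') *
                    Hu (request_time \<tau> e\<^sub>0 n\<^sub>0 - request_time \<tau>' e n)) *
                 Hu (t' - ta) * Hl (tb - t'))))))"
  using assms(2)
  \<comment> \<open>Strict precedence and equality exclude each other, so at most one summand of the
    bracket is nonzero and its value is 0 or 1.\<close>
  by (intro conjI interference_request_bound_eq_integral)
    (auto simp: interferes_static_def interferes_dm_def Hl_def Hu_def kronecker_def)

end
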